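(* Let $\boldsymbol{d}$ be an index-one saddle point of the gradient system $\frac{d\boldsymbol{w}}{dt}=-\nabla\ell(\boldsymbol{w})$, with a negative eigenvalue $\lambda_1$ of the Hessian matrix $H_\ell(\boldsymbol{d})$ of the loss function $\ell$. Then the saddle point $\boldsymbol{d}$ is an attractor of the SAM dynamics $$\boldsymbol{w}^p_t=\boldsymbol{w}_t+\rho\nabla\ell(\boldsymbol{w}_t),\qquad \boldsymbol{w}_{t+1}=\boldsymbol{w}_t-\eta\nabla\ell(\boldsymbol{w}^p_t)$$ if $\rho>-1/\lambda_1$.
   Context: $\ell$ is a loss function of the weight vector $\boldsymbol{w}\in\mathbb{R}^n$. $\nabla\ell(\boldsymbol{v})$ denotes the gradient of $\ell$ with respect to its input vector, evaluated at $\boldsymbol{v}$. SAM is sharpness-aware minimization: $\rho$ is the given neighborhood radius, taken constant (not normalized by the gradient norm), $\boldsymbol{w}^p_t$ is the perturbed weight, and $\eta$ is the learning rate. An equilibrium point of the gradient system is a point $\boldsymbol{w}$ with $\nabla\ell(\boldsymbol{w})=0$. It is called an index-$k$ saddle point if its Hessian matrix $H_\ell(\boldsymbol{w})=\nabla^2\ell(\boldsymbol{w})$ has exactly $k$ negative eigenvalues. So at an index-one saddle point, $\lambda_1$ is the only negative eigenvalue. "Attractor" is used in the usual sense of dynamical systems: an asymptotically stable equilibrium, to which trajectories starting sufficiently close to it converge.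
   Formalization: Zero is assumed not to be an eigenvalue of the Hessian at d, and the learning rate η is taken positive and below some threshold depending on the loss, d and ρ; without either condition the claim is false. *)

theory Defs
  imports "HOL-Analysis.Analysis" "HOL-Computational_Algebra.Polynomial"
begin

definition gradient :: "(real^'n \<Rightarrow> real) \<Rightarrow> real^'n \<Rightarrow> real^'n" where
  "gradient f x = (THE g. GDERIV f x :> g)"

definition hessian :: "(real^'n \<Rightarrow> real) \<Rightarrow> real^'n \<Rightarrow> real^'n^'n" where
  "hessian f x = jacobian (gradient f) (at x)"

definition eigenvalue :: "real^'n^'n \<Rightarrow> real \<Rightarrow> bool" where
  "eigenvalue A c \<longleftrightarrow> (\<exists>v. v \<noteq> 0 \<and> A *v v = c *\<^sub>R v)"

definition charpoly :: "real^'n^'n \<Rightarrow> real poly" where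
  "charpoly A = det (\<chi> i j. (if i = j then [:0, 1:] else 0) - [:A $ i $ j:])"

text \<open>Eigenvalues are counted with algebraic multiplicity, that is, with their order as
  roots of the characteristic polynomial.\<close>

definition num_neg_eigenvalues :: "real^'n^'n \<Rightarrow> nat" where
  "num_neg_eigenvalues A = (\<Sum>c | eigenvalue A c \<and> c < 0. order c (charpoly A))"

definition index_saddle :: "nat \<Rightarrow> (real^'n \<Rightarrow> real) \<Rightarrow> real^'n \<Rightarrow> bool" where
  "index_saddle k f x \<longleftrightarrow> gradient f x = 0 \<and> num_neg_eigenvalues (hessian f x) = k"

definition sam_perturb :: "(real^'n \<Rightarrow> real) \<Rightarrow> real \<Rightarrow> real^'n \<Rightarrow> real^'n" where
  "sam_perturb f \<rho> w = w + \<rho> *\<^sub>R gradient f w"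

definition sam_step :: "(real^'n \<Rightarrow> real) \<Rightarrow> real \<Rightarrow> real \<Rightarrow> real^'n \<Rightarrow> real^'n" where
  "sam_step f \<rho> \<eta> w = w - \<eta> *\<^sub>R gradient f (sam_perturb f \<rho> w)"

text \<open>An attractor of the discrete dynamical system \<open>w\<^sub>t\<^sub>+\<^sub>1 = F w\<^sub>t\<close>: a fixed point that is
  Lyapunov stable and locally attracting.\<close>

definition attractor :: "('a::metric_space \<Rightarrow> 'a) \<Rightarrow> 'a \<Rightarrow> bool" where
  "attractor F x \<longleftrightarrow>
     F x = x \<and>
     (\<forall>\<epsilon>>0. \<exists>\<delta>>0. \<forall>w. dist w x < \<delta> \<longrightarrow> (\<forall>t. dist ((F ^^ t) w) x < \<epsilon>)) \<and>
     (\<exists>\<delta>>0. \<forall>w. dist w x < \<delta> \<longrightarrow> (\<lambda>t. (F ^^ t) w) \<longlonglongrightarrow> x)"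

end

theory Submission
  imports Defs
begin

text \<open>
  The linearization of the SAM step at \<open>d\<close> is \<open>I - \<eta> H (I + \<rho> H)\<close>. Its eigenvalues are
  \<open>1 - \<eta> c (1 + \<rho> c)\<close> for the eigenvalues \<open>c\<close> of \<open>H\<close>, and \<open>c (1 + \<rho> c) > 0\<close> holds both for
  \<open>c > 0\<close> and for \<open>c = lambda1 < - 1 / \<rho>\<close>. The matrix \<open>H\<close> is symmetric because a gradient that is
  differentiable at a single point already has symmetric derivative there. So \<open>H (I + \<rho> H)\<close> is
  positive definite, and the step is a contraction towards \<open>d\<close> near \<open>d\<close> for small \<open>\<eta>\<close>.
\<close>

subsection \<open>Symmetry of the second derivative\<close>

text \<open>The mean value theorem in direction \<open>u\<close> alone turns the second difference
  into a difference of \<open>g\<close> at two points within O(s) of \<open>d\<close>. There the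
  linear approximation of \<open>g\<close> at \<open>d\<close> applies, so \<open>g\<close> need be
  differentiable only at \<open>d\<close>. The factor \<open>2 * norm u + norm v\<close> adds the
  distances of the two points from \<open>d\<close>, divided by \<open>s\<close>.\<close>

lemma mixed_second_difference:
  fixes f :: "'a::real_inner \<Rightarrow> real"
  assumes f: "\<And>x. GDERIV f x :> g x" and g: "(g has_derivative A) (at d)" and e: "e > 0"
  shows "\<forall>\<^sub>F s in at_right 0.
    \<bar>f (d + s *\<^sub>R u + s *\<^sub>R v) - f (d + s *\<^sub>R u) - f (d + s *\<^sub>R v) + f d - s\<^sup>2 * (u \<bullet> A v)\<bar>
      \<le> e * (norm u * (2 * norm u + norm v)) * s\<^sup>2"
proof -
  interpret A: bounded_linear A
    using g by (rule has_derivative_bounded_linear)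
  obtain r where r: "r > 0"
    and lin: "\<And>y. norm (y - d) < r \<Longrightarrow> norm (g y - g d - A (y - d)) \<le> e * norm (y - d)"
    using g e unfolding has_derivative_at_alt by blast
  \<comment> \<open>With \<open>s * K < r\<close> both \<open>y\<close> and \<open>z\<close> lie in
    the ball of radius \<open>r\<close>; the summand 1 keeps \<open>K\<close> positive when
    \<open>u\<close> and \<open>v\<close> vanish.\<close>
  define K where "K = norm u + norm v + 1"
  have K: "K > 0" unfolding K_def by (simp add: add_nonneg_pos)
  show ?thesis
    unfolding eventually_at_right_field
  proof (intro exI[of _ "r / K"] conjI allI impI)
    show "0 < r / K" using r K by simp
    fix s :: real assume s: "0 < s" "s < r / K"
    define \<phi> where "\<phi> t = f (d + t *\<^sub>R u + s *\<^sub>R v) - f (d + t *\<^sub>R u)" for t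
    have f': "(f has_derivative (\<lambda>h. h \<bullet> g x)) (at x)" for x
      using f gderiv_def by blast
    have \<phi>': "(\<phi> has_derivative
        (\<lambda>h. (h *\<^sub>R u) \<bullet> g (d + t *\<^sub>R u + s *\<^sub>R v) - (h *\<^sub>R u) \<bullet> g (d + t *\<^sub>R u))) (at t)" for t
      unfolding \<phi>_def
      by (intro has_derivative_diff has_derivative_compose[OF _ f'])
        (auto intro!: derivative_eq_intros)
    have cont: "continuous_on {0..s} \<phi>"
      using \<phi>' by (intro continuous_at_imp_continuous_on ballI has_derivative_continuous)
    obtain t where t: "0 < t" "t < s"
      and mvt: "\<phi> s - \<phi> 0 =
        ((s - 0) *\<^sub>R u) \<bullet> g (d + t *\<^sub>R u + s *\<^sub>R v) - ((s - 0) *\<^sub>R u) \<bullet> g (d + t *\<^sub>R u)"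
      by (rule mvt[OF s(1) cont \<phi>'])
    define y where "y = d + t *\<^sub>R u + s *\<^sub>R v"
    define z where "z = d + t *\<^sub>R u"
    have ny: "norm (y - d) \<le> s * (norm u + norm v)"
    proof -
      have "norm (y - d) \<le> t * norm u + s * norm v"
        using norm_triangle_ineq[of "t *\<^sub>R u" "s *\<^sub>R v"] t s by (simp add: y_def add.assoc)
      also have "\<dots> \<le> s * norm u + s * norm v"
        using t by (simp add: mult_right_mono)
      finally show ?thesis by (simp add: distrib_left)
    qed
    have nz: "norm (z - d) \<le> s * norm u"
      using t by (simp add: z_def mult_right_mono)
    have sK: "s * K < r" using s K by (simp add: field_simps)
    have yr: "norm (y - d) < r" and zr: "norm (z - d) < r"
    proof -
      have "s * (norm u + norm v) \<le> s * K" "s * norm u \<le> s * K"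
        using s by (auto simp: K_def)
      then show "norm (y - d) < r" "norm (z - d) < r" using ny nz sK by linarith+
    qed
    have "norm (g y - g z - A (s *\<^sub>R v))
      = norm ((g y - g d - A (y - d)) - (g z - g d - A (z - d)))"
      by (simp add: y_def z_def A.diff A.add algebra_simps)
    also have "\<dots> \<le> e * norm (y - d) + e * norm (z - d)"
      by (intro norm_triangle_le_diff add_mono lin yr zr)
    also have "\<dots> \<le> e * (s * (norm u + norm v)) + e * (s * norm u)"
      using ny nz e by (intro add_mono mult_left_mono) auto
    finally have diff: "norm (g y - g z - A (s *\<^sub>R v)) \<le> e * s * (2 * norm u + norm v)"
      by (simp add: algebra_simps)
    have "f (d + s *\<^sub>R u + s *\<^sub>R v) - f (d + s *\<^sub>R u) - f (d + s *\<^sub>R v) + f d - s\<^sup>2 * (u \<bullet> A v)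
      = (\<phi> s - \<phi> 0) - s\<^sup>2 * (u \<bullet> A v)"
      by (simp add: \<phi>_def)
    also have "\<dots> = s * (u \<bullet> (g y - g z - A (s *\<^sub>R v)))"
      unfolding mvt y_def z_def
      by (simp add: inner_diff_right A.scaleR power2_eq_square algebra_simps)
    finally have "\<bar>f (d + s *\<^sub>R u + s *\<^sub>R v) - f (d + s *\<^sub>R u) - f (d + s *\<^sub>R v) + f d
        - s\<^sup>2 * (u \<bullet> A v)\<bar> = s * \<bar>u \<bullet> (g y - g z - A (s *\<^sub>R v))\<bar>"
      using s by (simp add: abs_mult)
    also have "\<dots> \<le> s * (norm u * (e * s * (2 * norm u + norm v)))"
      using s by (intro mult_left_mono order_trans[OF Cauchy_Schwarz_ineq2] diff) auto
    finally show "\<bar>f (d + s *\<^sub>R u + s *\<^sub>R v) - f (d + s *\<^sub>R u) - f (d + s *\<^sub>R v) + f d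
        - s\<^sup>2 * (u \<bullet> A v)\<bar> \<le> e * (norm u * (2 * norm u + norm v)) * s\<^sup>2"
      by (simp add: power2_eq_square algebra_simps)
  qed
qed

text \<open>The second difference does not change when \<open>u\<close> and \<open>v\<close> are
  swapped, yet it approximates both forms times \<open>s\<^sup>2\<close>. Dividing by
  \<open>s\<^sup>2\<close> and letting \<open>e\<close> tend to 0 identifies them.\<close>

lemma gderiv_derivative_symmetric:
  fixes f :: "'a::real_inner \<Rightarrow> real"
  assumes f: "\<And>x. GDERIV f x :> g x" and g: "(g has_derivative A) (at d)"
  shows "u \<bullet> A v = v \<bullet> A u"
proof -
  define C where "C = norm u * (2 * norm u + norm v) + norm v * (2 * norm v + norm u)"
  have C: "C \<ge> 0" by (simp add: C_def)
  have bound: "\<bar>u \<bullet> A v - v \<bullet> A u\<bar> \<le> e * C" if e: "e > 0" for e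
  proof -
    have "\<forall>\<^sub>F s in at_right (0::real). \<bar>u \<bullet> A v - v \<bullet> A u\<bar> \<le> e * C"
      using mixed_second_difference[OF f g e, of u v] mixed_second_difference[OF f g e, of v u]
        eventually_at_right_less[of 0]
    proof eventually_elim
      case (elim s)
      have "d + s *\<^sub>R u + s *\<^sub>R v = d + s *\<^sub>R v + s *\<^sub>R u" by simp
      then have "\<bar>s\<^sup>2 * (u \<bullet> A v) - s\<^sup>2 * (v \<bullet> A u)\<bar>
        \<le> e * (norm u * (2 * norm u + norm v)) * s\<^sup>2 + e * (norm v * (2 * norm v + norm u)) * s\<^sup>2"
        using elim(1,2) by (smt (verit))
      also have "s\<^sup>2 * (u \<bullet> A v) - s\<^sup>2 * (v \<bullet> A u) = s\<^sup>2 * (u \<bullet> A v - v \<bullet> A u)"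
        by (simp add: right_diff_distrib)
      finally have "s\<^sup>2 * \<bar>u \<bullet> A v - v \<bullet> A u\<bar> \<le> s\<^sup>2 * (e * C)"
        by (simp add: C_def abs_mult distrib_left ac_simps)
      then show ?case using elim(3) by simp
    qed
    \<comment> \<open>The inequality is free of \<open>s\<close>, and \<open>at_right 0\<close> is a
      nontrivial filter.\<close>
    then show ?thesis by simp
  qed
  have "\<bar>u \<bullet> A v - v \<bullet> A u\<bar> \<le> 0"
  proof (rule field_le_epsilon)
    fix e :: real assume "e > 0"
    then have "\<bar>u \<bullet> A v - v \<bullet> A u\<bar> \<le> e / (C + 1) * C" using C by (intro bound) simp
    also have "\<dots> \<le> e" using C \<open>e > 0\<close> by (simp add: field_simps)
    finally show "\<bar>u \<bullet> A v - v \<bullet> A u\<bar> \<le> 0 + e" by simp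
  qed
  then show ?thesis by simp
qed

subsection \<open>Positive definite operators\<close>

text \<open>The minimum \<open>m\<close> of the quadratic form on the unit sphere is attained by
  compactness. Then \<open>B = A - m\<close> is positive semidefinite with
  \<open>v \<bullet> B v = 0\<close>, and moving \<open>v\<close> along \<open>B v\<close> would
  make the form of \<open>B\<close> negative unless \<open>B v = 0\<close>.\<close>

lemma symmetric_min_eigenvalue:
  fixes A :: "'a::euclidean_space \<Rightarrow> 'a"
  assumes lin: "linear A" and sym: "\<And>x y. x \<bullet> A y = y \<bullet> A x"
  obtains v m where "v \<noteq> 0" "A v = m *\<^sub>R v" "\<And>x. m * (norm x)\<^sup>2 \<le> x \<bullet> A x"
proof -
  interpret linear A by fact
  have "continuous_on (sphere 0 1) (\<lambda>x. x \<bullet> A x)"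
    using lin by (intro continuous_intros linear_continuous_on linear_conv_bounded_linear[THEN iffD1])
  moreover have "sphere (0::'a) 1 \<noteq> {}" by simp
  ultimately obtain v where v: "norm v = 1"
    and min: "\<And>x. norm x = 1 \<Longrightarrow> v \<bullet> A v \<le> x \<bullet> A x"
    using continuous_attains_inf[of "sphere (0::'a) 1" "\<lambda>x. x \<bullet> A x"] by auto
  define m where "m = v \<bullet> A v"
  have coercive: "m * (norm x)\<^sup>2 \<le> x \<bullet> A x" for x
  proof (cases "x = 0")
    case False
    then have "m \<le> sgn x \<bullet> A (sgn x)" unfolding m_def by (intro min) (simp add: norm_sgn)
    also have "\<dots> = x \<bullet> A x / (norm x)\<^sup>2"
      by (simp add: sgn_div_norm scale power2_eq_square field_simps)
    finally show ?thesis using False by (simp add: field_simps)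
  qed simp
  define B where "B x = A x - m *\<^sub>R x" for x
  define n where "n = B v \<bullet> B v"
  define c where "c = B v \<bullet> B (B v)"
  have nonneg: "x \<bullet> B x \<ge> 0" for x
    using coercive[of x] by (simp add: B_def inner_diff_right power2_norm_eq_inner)
  have Bv: "v \<bullet> B v = 0"
    using v by (simp add: B_def inner_diff_right m_def flip: power2_norm_eq_inner)
  have Bsym: "x \<bullet> B y = y \<bullet> B x" for x y
    by (simp add: B_def inner_diff_right sym[of x y] inner_commute)
  have "B (v + t *\<^sub>R w) = B v + t *\<^sub>R B w" for t w
    by (simp add: B_def add scale algebra_simps)
  then have expand: "0 \<le> 2 * t * n + t\<^sup>2 * c" for t
    using nonneg[of "v + t *\<^sub>R B v"] Bsym[of v "B v"]
    by (simp add: Bv inner_add_left inner_add_right n_def c_def power2_eq_square algebra_simps)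
  have c: "c \<ge> 0" unfolding c_def by (rule nonneg)
  have "n = 0"
  proof (rule ccontr)
    assume "n \<noteq> 0"
    \<comment> \<open>A small negative \<open>t\<close> lets the linear term win; the denominator is
      \<open>c + 1\<close> because \<open>c\<close> may be 0.\<close>
    have "2 * (- n / (c + 1)) * n + (- n / (c + 1))\<^sup>2 * c = - (n\<^sup>2 * (c + 2) / (c + 1)\<^sup>2)"
      using c by (simp add: divide_simps power2_eq_square) (simp add: algebra_simps)
    moreover have "n\<^sup>2 * (c + 2) / (c + 1)\<^sup>2 > 0" using c \<open>n \<noteq> 0\<close> by simp
    ultimately show False using expand[of "- n / (c + 1)"] by linarith
  qed
  then have "A v = m *\<^sub>R v" by (simp add: n_def B_def)
  with v coercive show thesis by (intro that[of v m]) auto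
qed

text \<open>The least eigenvalue \<open>m\<close> of the symmetric operator \<open>M\<close> is the
  desired bound once it is positive. Its eigenvector need not be one of \<open>A\<close>, so an
  eigenvector of \<open>A\<close> to which \<open>eig\<close> applies is extracted from it.\<close>

lemma quadratic_operator_coercive:
  fixes A :: "'a::euclidean_space \<Rightarrow> 'a"
  assumes lin: "linear A" and sym: "\<And>x y. x \<bullet> A y = y \<bullet> A x" and \<rho>: "\<rho> > 0"
    and eig: "\<And>c v. v \<noteq> 0 \<Longrightarrow> A v = c *\<^sub>R v \<Longrightarrow> c * (1 + \<rho> * c) > 0"
  obtains m where "m > 0" "\<And>x. m * (norm x)\<^sup>2 \<le> x \<bullet> A (x + \<rho> *\<^sub>R A x)"
proof -
  interpret linear A by fact
  define M where "M x = A (x + \<rho> *\<^sub>R A x)" for x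
  have "linear M"
    unfolding M_def by (rule linearI) (simp_all add: add scale algebra_simps)
  moreover have "x \<bullet> M y = y \<bullet> M x" for x y
    using sym[of x y] sym[of x "A y"] sym[of y "A x"]
    by (simp add: M_def add scale inner_add_right inner_commute)
  ultimately obtain v m where v: "v \<noteq> 0" and Mv: "M v = m *\<^sub>R v"
    and le: "\<And>x. m * (norm x)\<^sup>2 \<le> x \<bullet> M x"
    by (rule symmetric_min_eigenvalue) (rule that)
  have Mv': "A (A v) = (m / \<rho>) *\<^sub>R v - (1 / \<rho>) *\<^sub>R A v"
  proof -
    have "\<rho> *\<^sub>R A (A v) = m *\<^sub>R v - A v"
      using Mv by (simp add: M_def add scale algebra_simps)
    then have "(1 / \<rho>) *\<^sub>R \<rho> *\<^sub>R A (A v) = (1 / \<rho>) *\<^sub>R (m *\<^sub>R v - A v)" by simp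
    then show ?thesis using \<rho> by (simp add: scaleR_diff_right)
  qed
  txt \<open>The quadratic \<open>\<rho> c\<^sup>2 + c - m\<close>, which annihilates \<open>v\<close> at \<open>A\<close>, has real roots since the square
    of the norm of \<open>2 \<rho> A v + v\<close> is its discriminant times that of \<open>v\<close>. One of the roots is then
    an eigenvalue of \<open>A\<close>.\<close>
  have disc: "1 + 4 * \<rho> * m \<ge> 0"
  proof -
    have "v \<bullet> A (A v) = A v \<bullet> A v" using sym[of v "A v"] by simp
    then have "\<rho> * (A v \<bullet> A v) = m * (v \<bullet> v) - v \<bullet> A v"
      using \<rho> Mv' by (simp add: inner_diff_right field_simps)
    then have "4 * \<rho> * (\<rho> * (A v \<bullet> A v)) = 4 * \<rho> * (m * (v \<bullet> v) - v \<bullet> A v)" by simp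
    then have "(norm ((2 * \<rho>) *\<^sub>R A v + v))\<^sup>2 = (1 + 4 * \<rho> * m) * (norm v)\<^sup>2"
      by (simp add: power2_norm_eq_inner inner_add_left inner_add_right inner_commute algebra_simps)
    then have "0 \<le> (1 + 4 * \<rho> * m) * (norm v)\<^sup>2" by (metis zero_le_power2)
    then show ?thesis using v by (simp add: zero_le_mult_iff)
  qed
  define s where "s = sqrt (1 + 4 * \<rho> * m)"
  have s2: "s * s = 1 + 4 * \<rho> * m" using disc by (simp add: s_def)
  define a where "a = (- 1 + s) / (2 * \<rho>)"
  define b where "b = (- 1 - s) / (2 * \<rho>)"
  have root: "a * (1 + \<rho> * a) = m" "b * (1 + \<rho> * b) = m"
    using \<rho> s2 by (simp_all add: a_def b_def divide_simps) (simp_all add: algebra_simps)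
  have vieta: "a + b = - 1 / \<rho>" "a * b = - m / \<rho>"
    using \<rho> s2 by (simp_all add: a_def b_def divide_simps) (simp_all add: algebra_simps)
  \<comment> \<open>Since \<open>(A - a) (A - b) v = 0\<close>, either \<open>v\<close> belongs to
    \<open>b\<close> or \<open>A v - b v\<close> is an eigenvector for \<open>a\<close>. Both roots
    satisfy \<open>c * (1 + \<rho> * c) = m\<close>.\<close>
  have "m > 0"
  proof (cases "A v = b *\<^sub>R v")
    case True
    then show ?thesis using eig[OF v] root by metis
  next
    case False
    have "A (A v - b *\<^sub>R v) - a *\<^sub>R (A v - b *\<^sub>R v) = A (A v) - (a + b) *\<^sub>R A v + (a * b) *\<^sub>R v"
      by (simp add: diff scale algebra_simps)
    also have "\<dots> = 0" unfolding vieta Mv' by simp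
    finally have "A (A v - b *\<^sub>R v) = a *\<^sub>R (A v - b *\<^sub>R v)" by simp
    then show ?thesis using eig[of "A v - b *\<^sub>R v" a] False root by simp
  qed
  then show thesis using le that M_def by metis
qed

subsection \<open>Attractors\<close>

text \<open>Distances to \<open>x\<close> never grow, so orbits stay in the ball where
  \<open>contr\<close> applies and decay geometrically.\<close>

lemma contraction_imp_attractor:
  assumes fix_pt: "F x = x" and q: "0 \<le> q" "q < 1" and r: "r > 0"
    and contr: "\<And>w. dist w x < r \<Longrightarrow> dist (F w) x \<le> q * dist w x"
  shows "attractor F x"
proof -
  have iter: "dist ((F ^^ t) w) x \<le> q ^ t * dist w x" if w: "dist w x < r" for t w
  proof (induction t)
    case (Suc t)
    have "q ^ t * dist w x \<le> dist w x"
      using q by (simp add: mult_left_le_one_le power_le_one)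
    then have "dist (F ((F ^^ t) w)) x \<le> q * dist ((F ^^ t) w) x"
      using Suc w by (intro contr) linarith
    also have "\<dots> \<le> q * (q ^ t * dist w x)" using Suc q by (intro mult_left_mono)
    finally show ?case by (simp add: mult.assoc)
  qed simp
  have stable: "\<exists>\<delta>>0. \<forall>w. dist w x < \<delta> \<longrightarrow> (\<forall>t. dist ((F ^^ t) w) x < \<epsilon>)" if "\<epsilon> > 0" for \<epsilon>
  proof (intro exI[of _ "min \<epsilon> r"] conjI allI impI)
    fix w t assume w: "dist w x < min \<epsilon> r"
    have "q ^ t * dist w x \<le> dist w x"
      using q by (simp add: mult_left_le_one_le power_le_one)
    then show "dist ((F ^^ t) w) x < \<epsilon>" using iter[of w t] w by linarith
  qed (use r that in simp)
  have "(\<lambda>t. (F ^^ t) w) \<longlonglongrightarrow> x" if w: "dist w x < r" for w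
  proof -
    have "(\<lambda>t. q ^ t * dist w x) \<longlonglongrightarrow> 0"
      using tendsto_mult_right[OF LIMSEQ_realpow_zero[OF q], of "dist w x"] by simp
    then have "(\<lambda>t. dist ((F ^^ t) w) x) \<longlonglongrightarrow> 0"
      by (rule Lim_null_comparison[rotated]) (simp add: iter[OF w])
    then show ?thesis by (rule tendsto_dist_iff[THEN iffD2])
  qed
  then have "\<exists>\<delta>>0. \<forall>w. dist w x < \<delta> \<longrightarrow> (\<lambda>t. (F ^^ t) w) \<longlonglongrightarrow> x" using r by blast
  with fix_pt stable show ?thesis unfolding attractor_def by simp
qed

text \<open>In the expansion of the squared norm of \<open>x - \<eta> M x\<close>, coercivity makes
  the cross term at most \<open>- 2 \<eta> m\<close> times that of \<open>x\<close>, and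
  \<open>\<eta> < m / K\<^sup>2\<close> lets the quadratic term undo at most half of this
  gain.\<close>

lemma small_step_attractor:
  fixes G :: "'a::euclidean_space \<Rightarrow> 'a"
  assumes G: "(G has_derivative M) (at d)" and zero: "G d = 0"
    and m: "m > 0" and coercive: "\<And>x. m * (norm x)\<^sup>2 \<le> x \<bullet> M x"
  shows "\<exists>\<eta>\<^sub>0>0. \<forall>\<eta>. 0 < \<eta> \<and> \<eta> < \<eta>\<^sub>0 \<longrightarrow> attractor (\<lambda>w. w - \<eta> *\<^sub>R G w) d"
proof -
  interpret M: bounded_linear M using G by (rule has_derivative_bounded_linear)
  obtain K where K: "K > 0" "\<And>x. norm (M x) \<le> norm x * K" using M.pos_bounded by blast
  have contr: "(norm (x - \<eta> *\<^sub>R M x))\<^sup>2 \<le> (1 - \<eta> * m) * (norm x)\<^sup>2"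
    if \<eta>: "0 < \<eta>" "\<eta> < m / K\<^sup>2" for \<eta> x
  proof -
    have "(norm (M x))\<^sup>2 \<le> (norm x * K)\<^sup>2" using K by (intro power_mono) auto
    then have "\<eta> * (\<eta> * (norm (M x))\<^sup>2) \<le> \<eta> * (\<eta> * (norm x * K)\<^sup>2)" using \<eta> by simp
    also have "\<eta> * (norm x * K)\<^sup>2 \<le> m * (norm x)\<^sup>2"
    proof -
      have "\<eta> * K\<^sup>2 \<le> m" using \<eta> K by (simp add: field_simps)
      from mult_right_mono[OF this, of "(norm x)\<^sup>2"] show ?thesis
        by (simp add: power_mult_distrib ac_simps)
    qed
    finally have 1: "\<eta> * (\<eta> * (norm (M x))\<^sup>2) \<le> \<eta> * (m * (norm x)\<^sup>2)" using \<eta> by simp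
    have 2: "\<eta> * (m * (norm x)\<^sup>2) \<le> \<eta> * (x \<bullet> M x)" using coercive \<eta> by simp
    have "(norm (x - \<eta> *\<^sub>R M x))\<^sup>2 = (norm x)\<^sup>2 - 2 * (\<eta> * (x \<bullet> M x)) + \<eta> * (\<eta> * (norm (M x))\<^sup>2)"
      by (simp add: power2_norm_eq_inner inner_diff_left inner_diff_right inner_commute)
    then show ?thesis using 1 2 by (simp add: algebra_simps)
  qed
  \<comment> \<open>The bound \<open>1 / m\<close> keeps \<open>1 - \<eta> * m\<close> positive
    under the square root.\<close>
  have "attractor (\<lambda>w. w - \<eta> *\<^sub>R G w) d" if \<eta>: "0 < \<eta>" "\<eta> < min (m / K\<^sup>2) (1 / m)" for \<eta>
  proof -
    define p where "p = sqrt (1 - \<eta> * m)"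
    have \<eta>m: "0 < \<eta> * m" "\<eta> * m < 1" using \<eta> m by (simp_all add: field_simps)
    have p: "0 \<le> p" "p < 1" using \<eta>m by (simp_all add: p_def)
    have lin: "norm (x - \<eta> *\<^sub>R M x) \<le> p * norm x" for x
    proof -
      have "norm (x - \<eta> *\<^sub>R M x) = sqrt ((norm (x - \<eta> *\<^sub>R M x))\<^sup>2)" by simp
      also have "\<dots> \<le> sqrt ((1 - \<eta> * m) * (norm x)\<^sup>2)"
        using contr \<eta> by (intro real_sqrt_le_mono) auto
      finally show ?thesis by (simp add: p_def real_sqrt_mult)
    qed
    \<comment> \<open>After multiplication by \<open>\<eta>\<close> the remainder uses half of the
      gap \<open>1 - p\<close>, leaving the contraction factor \<open>(1 + p) / 2\<close>.\<close>
    have "(1 - p) / (2 * \<eta>) > 0" using p \<eta> by simp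
    then obtain r where r: "r > 0"
      and rem: "\<And>w. norm (w - d) < r \<Longrightarrow>
        norm (G w - G d - M (w - d)) \<le> (1 - p) / (2 * \<eta>) * norm (w - d)"
      using G unfolding has_derivative_at_alt by blast
    show ?thesis
    proof (rule contraction_imp_attractor)
      show "d - \<eta> *\<^sub>R G d = d" by (simp add: zero)
      show "0 \<le> (1 + p) / 2" "(1 + p) / 2 < 1" "r > 0" using p r by auto
      fix w assume "dist w d < r"
      then have "\<eta> * norm (G w - G d - M (w - d)) \<le> \<eta> * ((1 - p) / (2 * \<eta>) * norm (w - d))"
        using rem \<eta> by (intro mult_left_mono) (auto simp: dist_norm)
      also have "\<dots> = (1 - p) / 2 * norm (w - d)" using \<eta> by simp
      finally have R: "norm (\<eta> *\<^sub>R (G w - M (w - d))) \<le> (1 - p) / 2 * norm (w - d)"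
        using \<eta> by (simp add: zero)
      have "w - \<eta> *\<^sub>R G w - d = ((w - d) - \<eta> *\<^sub>R M (w - d)) - \<eta> *\<^sub>R (G w - M (w - d))"
        by (simp add: algebra_simps)
      then have "norm (w - \<eta> *\<^sub>R G w - d) \<le> p * norm (w - d) + (1 - p) / 2 * norm (w - d)"
        by (metis norm_triangle_le_diff add_mono[OF lin R])
      then show "dist (w - \<eta> *\<^sub>R G w) d \<le> (1 + p) / 2 * dist w d"
        by (simp add: dist_norm field_simps)
    qed
  qed
  moreover have "min (m / K\<^sup>2) (1 / m) > 0" using m K by simp
  ultimately show ?thesis by blast
qed

subsection \<open>Counting negative eigenvalues\<close>

lemma poly_det:
  fixes A :: "'a::comm_ring_1 poly^'n^'n"
  shows "poly (det A) c = det (\<chi> i j. poly (A $ i $ j) c)"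
  by (simp add: det_def poly_sum poly_prod poly_mult)

lemma eigenvalue_iff_root: "eigenvalue A c \<longleftrightarrow> poly (charpoly A) c = 0"
proof -
  have "poly (charpoly A) c = det (c *\<^sub>R mat 1 - A)"
    unfolding charpoly_def poly_det by (rule arg_cong[of _ _ det]) (auto simp: vec_eq_iff mat_def)
  moreover have "det (c *\<^sub>R mat 1 - A) = 0 \<longleftrightarrow> (\<exists>v. v \<noteq> 0 \<and> (c *\<^sub>R mat 1 - A) *v v = 0)"
    using invertible_det_nz[of "c *\<^sub>R mat 1 - A"]
    by (auto simp: invertible_left_inverse matrix_left_invertible_ker)
  moreover have "(c *\<^sub>R mat 1 - A) *v v = c *\<^sub>R v - A *v v" for v
    by (simp add: matrix_vector_mult_diff_rdistrib scaleR_matrix_vector_assoc[symmetric])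
  ultimately show ?thesis by (auto simp: eigenvalue_def)
qed

text \<open>For the zero polynomial every negative number would be a root, and a sum over an
  infinite set is 0 by convention.\<close>

lemma charpoly_nonzero_if_num_neg_eigenvalues:
  assumes "num_neg_eigenvalues A \<noteq> 0"
  shows "charpoly A \<noteq> 0"
proof
  assume "charpoly A = 0"
  then have "{c. eigenvalue A c \<and> c < 0} = {..<0}" by (auto simp: eigenvalue_iff_root)
  then show False using assms by (simp add: num_neg_eigenvalues_def infinite_Iio)
qed

text \<open>Each eigenvalue is a root of order at least 1, so two distinct negative ones would make
  the count at least 2.\<close>

lemma negative_eigenvalue_unique:
  assumes one: "num_neg_eigenvalues A = 1"
    and a: "eigenvalue A a" "a < 0" and b: "eigenvalue A b" "b < 0"
  shows "a = b"
proof (rule ccontr)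
  assume ab: "a \<noteq> b"
  have nz: "charpoly A \<noteq> 0" using charpoly_nonzero_if_num_neg_eigenvalues[of A] one by simp
  have "finite {c. eigenvalue A c \<and> c < 0}"
    by (rule finite_subset[OF _ poly_roots_finite[OF nz]]) (auto simp: eigenvalue_iff_root)
  then have "(\<Sum>c\<in>{a, b}. order c (charpoly A)) \<le> num_neg_eigenvalues A"
    unfolding num_neg_eigenvalues_def using a b by (intro sum_mono2) auto
  moreover have "order a (charpoly A) \<noteq> 0" "order b (charpoly A) \<noteq> 0"
    using a b nz by (auto simp: eigenvalue_iff_root order_root)
  ultimately show False using ab one by simp
qed

section \<open>Gradients and the SAM step\<close>

text \<open>The adjoint of the derivative, applied to 1, represents it as an inner product;
  uniqueness justifies the \<open>THE\<close> in \<open>gradient\<close>.\<close>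

lemma gradient_GDERIV:
  fixes f :: "real^'n \<Rightarrow> real"
  assumes "f differentiable (at x)"
  shows "GDERIV f x :> gradient f x"
proof -
  obtain D where D: "(f has_derivative D) (at x)" using assms differentiable_def by blast
  have "D h = h \<bullet> adjoint D 1" for h
    using adjoint_works[OF has_derivative_linear[OF D], of h 1] by simp
  then have "D = (\<lambda>h. h \<bullet> adjoint D 1)" by (rule ext)
  with D have ex: "GDERIV f x :> adjoint D 1" by (simp add: gderiv_def)
  have "g = adjoint D 1" if "GDERIV f x :> g" for g
  proof -
    have "(\<lambda>h. h \<bullet> g) = (\<lambda>h. h \<bullet> adjoint D 1)"
      using that ex unfolding gderiv_def by (rule has_derivative_unique)
    then show ?thesis by (metis inner_commute vector_eq_rdot)
  qed
  then show ?thesis unfolding gradient_def using ex by (metis theI)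
qed

text \<open>The count of negative eigenvalues says nothing about the eigenvalue 0, which would give
  the linearized step an eigenvalue 1; \<open>nondegenerate\<close> excludes it. The learning rate
  must be small because a large \<open>\<eta>\<close> overshoots.\<close>

theorem theorem1:
  fixes l :: "real^'n \<Rightarrow> real" and d :: "real^'n" and lambda1 \<rho> :: real
  assumes l_diff: "\<And>x. l differentiable (at x)"
    and grad_diff: "gradient l differentiable (at d)"
    and saddle: "index_saddle 1 l d"
    and nondegenerate: "\<not> eigenvalue (hessian l d) 0"
    and eig: "eigenvalue (hessian l d) lambda1" and neg: "lambda1 < 0"
    and rho: "\<rho> > - 1 / lambda1"
  shows "\<exists>\<eta>\<^sub>0>0. \<forall>\<eta>. 0 < \<eta> \<and> \<eta> < \<eta>\<^sub>0 \<longrightarrow> attractor (sam_step l \<rho> \<eta>) d"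
proof -
  define A where "A x = hessian l d *v x" for x
  have grad: "(gradient l has_derivative A) (at d)"
    using grad_diff unfolding A_def hessian_def jacobian_works .
  have lin: "linear A" using has_derivative_linear[OF grad] .
  have sym: "x \<bullet> A y = y \<bullet> A x" for x y
    using gderiv_derivative_symmetric[OF gradient_GDERIV[OF l_diff] grad] .
  have "- 1 / lambda1 > 0" using neg by (simp add: divide_less_0_iff)
  then have \<rho>: "\<rho> > 0" using rho by linarith
  have eigs: "c * (1 + \<rho> * c) > 0" if "v \<noteq> 0" "A v = c *\<^sub>R v" for c v
  proof -
    have c: "eigenvalue (hessian l d) c" using that by (auto simp: eigenvalue_def A_def)
    consider "c > 0" | "c < 0" using c nondegenerate by fastforce
    then show ?thesis
    proof cases
      case 1
      then show ?thesis using \<rho> by (simp add: add_pos_pos)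
    next
      case 2
      then have "c = lambda1"
        using negative_eigenvalue_unique saddle c eig neg unfolding index_saddle_def by blast
      then have "1 + \<rho> * c < 0" using rho neg by (simp add: field_simps)
      then show ?thesis using 2 by (simp add: mult_neg_neg)
    qed
  qed
  obtain m where m: "m > 0" "\<And>x. m * (norm x)\<^sup>2 \<le> x \<bullet> A (x + \<rho> *\<^sub>R A x)"
    by (rule quadratic_operator_coercive[OF lin sym \<rho>]) (rule eigs, assumption+, rule that)
  have d: "gradient l d = 0" using saddle by (simp add: index_saddle_def)
  have "(sam_perturb l \<rho> has_derivative (\<lambda>x. x + \<rho> *\<^sub>R A x)) (at d)"
    unfolding sam_perturb_def[abs_def]
    by (intro has_derivative_add has_derivative_ident has_derivative_scaleR_right grad)
  \<comment> \<open>The perturbation fixes \<open>d\<close>, where the gradient vanishes, so the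
    chain rule differentiates the outer gradient at \<open>d\<close> too.\<close>
  then have deriv: "((\<lambda>w. gradient l (sam_perturb l \<rho> w)) has_derivative (\<lambda>x. A (x + \<rho> *\<^sub>R A x))) (at d)"
    by (rule has_derivative_compose) (simp add: sam_perturb_def d grad)
  have "gradient l (sam_perturb l \<rho> d) = 0" by (simp add: sam_perturb_def d)
  from small_step_attractor[OF deriv this m] show ?thesis
    unfolding sam_step_def[abs_def] .
qed

end
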